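(* Let $m\in\mathbb{N}_+$ and $\vartheta=1/\sqrt{m}$. Let $\varphi:\mathbb{N}_+\to(0,+\infty)$ be a function, and define $$A_\varphi=\{x\in\Omega:\ b_n(x)>\varphi(n)\ \text{for infinitely many } n\in\mathbb{N}_+\}.$$ Then $$\lambda_\vartheta(A_\varphi)=\begin{cases}0,&\text{if }\sum_{n\ge1}\frac1{\varphi(n)}<\infty,\\[2pt] 1,&\text{if }\sum_{n\ge1}\frac1{\varphi(n)}=\infty.\end{cases}$$
   Context: $\mathbb{N}_+=\{1,2,3,\ldots\}$. Fix $m\in\mathbb{N}_+$ and let $\vartheta>0$ satisfy $\vartheta^2=1/m$. Define $T_\vartheta:[0,\vartheta]\to[0,\vartheta]$ by $T_\vartheta(0)=0$ and $T_\vartheta(x)=\frac1x-\vartheta\left\lfloor\frac1{x\vartheta}\right\rfloor$ for $x\in(0,\vartheta]$. The digits of the $\vartheta$-expansion of $x\in[0,\vartheta]$ are $b_1(x)=\left\lfloor\frac1{x\vartheta}\right\rfloor$ if $x\ne0$, $b_1(0)=\infty$, and $b_n(x)=b_1(T_\vartheta^{n-1}(x))$ for $n\ge2$. $\Omega=(0,\vartheta)\setminus\mathbb{Q}$. $\lambda_\vartheta$ is the normalized Lebesgue measure on $[0,\vartheta]$ (Lebesgue measure divided by $\vartheta$, so a probability measure). *)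

theory Defs
  imports "HOL-Analysis.Analysis"
begin

text \<open>
  The parameter \<open>\<theta>\<close> is \<open>1 / sqrt m\<close> for a positive integer \<open>m\<close>. The maps below are total on the
  reals, but are meant to be applied only to points of \<open>{0..\<theta>}\<close>.
\<close>

definition T_map :: "real \<Rightarrow> real \<Rightarrow> real" where
  "T_map \<theta> x = (if x = 0 then 0 else 1 / x - \<theta> * of_int \<lfloor>1 / (x * \<theta>)\<rfloor>)"

definition first_digit :: "real \<Rightarrow> real \<Rightarrow> enat" where
  "first_digit \<theta> x = (if x = 0 then \<infinity> else enat (nat \<lfloor>1 / (x * \<theta>)\<rfloor>))"

text \<open>Digits are indexed from 1; the value at index 0 is meaningless.\<close>

definition digit :: "real \<Rightarrow> nat \<Rightarrow> real \<Rightarrow> enat" where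
  "digit \<theta> n x = first_digit \<theta> ((T_map \<theta> ^^ (n - 1)) x)"

definition Omega :: "real \<Rightarrow> real set" where
  "Omega \<theta> = {0<..<\<theta>} - \<rat>"

definition lambda_measure :: "real \<Rightarrow> real measure" where
  "lambda_measure \<theta> = scale_measure (ennreal (1 / \<theta>)) (restrict_space lborel {0..\<theta>})"

text \<open>
  If \<open>\<theta>\<close> is irrational, the expansion of a point of \<open>Omega \<theta>\<close> can terminate, so infinite digits do
  occur there; hence the comparison takes place in the extended reals.
\<close>

definition A_set :: "real \<Rightarrow> (nat \<Rightarrow> real) \<Rightarrow> real set" where
  "A_set \<theta> \<phi> =
     {x \<in> Omega \<theta>. infinite {n. 1 \<le> n \<and> ereal_of_enat (digit \<theta> n x) > ereal (\<phi> n)}}"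

end

theory Submission
  imports Defs "HOL-Real_Asymp.Real_Asymp"
begin

text \<open>
  After the change of variable \<open>x = \<theta> * y\<close> the expansion is generated by the map \<open>y \<mapsto> frac (m / y)\<close> of
  the unit interval, because \<open>1 / \<theta> = m * \<theta>\<close>, and the digits are \<open>\<lfloor>m / y\<rfloor> \<ge> m\<close>. The event that the \<open>n\<close>-th
  digit exceeds \<open>c\<close> is essentially the event that the orbit at time \<open>n - 1\<close> lies to the left of \<open>m / c\<close>.
  If the digits were independent, the theorem would be the two halves of the Borel-Cantelli lemma, and
  it remains to control the dependence.

  The control comes from a one-parameter family of laws on the unit interval, with distribution
  functions \<open>s \<mapsto> s * (1 + t) / (1 + t * s)\<close> for \<open>0 \<le> t \<le> 1\<close>; the parameter \<open>t = 0\<close> is Lebesgue measure.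
  If \<open>y\<close> has the law with parameter \<open>t\<close>, then the image of \<open>y\<close>, conditioned on the first digit being
  \<open>a\<close>, has exactly the law with parameter \<open>1 / (a + t * m)\<close> (\<open>mobius_law_branch\<close>). So the family is
  closed under conditioning on digits, and any estimate that is uniform over the family persists after
  any initial string of digits has been prescribed (\<open>mobius_law_transfer\<close>).

  Uniformly over the family, the interval from \<open>0\<close> to \<open>s\<close> has mass between \<open>s\<close> and \<open>2 * s\<close>. Hence each
  digit exceeds \<open>c\<close> with probability at most \<open>2 * m / c\<close>, and if \<open>\<Sum>n. 1 / \<phi> n\<close> converges, almost every
  point has only finitely many large digits. Conversely, whatever the preceding digits are, the next
  digit is at most \<open>c\<close> with conditional probability at most \<open>1 - 1 / (c + 1)\<close>. So the probability of
  meeting no large digit from some time on is bounded by an infinite product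
  (\<open>mobius_law_no_large_digit\<close>), which vanishes when the series diverges.
\<close>

section \<open>The rescaled map and the Moebius laws\<close>

text \<open>
  This is the map of the expansion in the coordinate \<open>y = x / \<theta>\<close>. For \<open>m = 1\<close> it is the Gauss map.
\<close>

definition scaled_gauss_map :: "nat \<Rightarrow> real \<Rightarrow> real" where
  "scaled_gauss_map m y = frac (real m / y)"

text \<open>
  The Moebius maps of \<open>s\<close> that fix \<open>0\<close> and \<open>1\<close>, parametrised by the pole \<open>- 1 / t\<close>. As distribution
  functions on the unit interval they form a family that is preserved, up to affine normalisation, when
  an inverse branch of the map is substituted for \<open>s\<close>.
\<close>
definition mobius_cdf :: "real \<Rightarrow> real \<Rightarrow> real" where
  "mobius_cdf t s = s * (1 + t) / (1 + t * s)"

definition mobius_law :: "real \<Rightarrow> real measure" where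
  "mobius_law t =
     density lborel (\<lambda>y. ennreal ((1 + t) / (1 + t * y)\<^sup>2) * indicator {0<..1} y)"

lemma sets_mobius_law [measurable_cong, simp]: "sets (mobius_law t) = sets borel"
  by (simp add: mobius_law_def)

lemma space_mobius_law [simp]: "space (mobius_law t) = UNIV"
  by (simp add: mobius_law_def)

lemma measurable_scaled_gauss_map [measurable]: "scaled_gauss_map m \<in> borel_measurable borel"
  unfolding scaled_gauss_map_def frac_def by measurable

lemma mobius_law_cong:
  assumes "A \<in> sets borel" "B \<in> sets borel" "A \<inter> {0<..1} = B \<inter> {0<..1}"
  shows "emeasure (mobius_law t) A = emeasure (mobius_law t) B"
proof -
  have "indicator {0<..1} y * indicator A y = (indicator {0<..1} y * indicator B y :: ennreal)" for y
    unfolding indicator_inter_arith[symmetric] by (simp only: Int_commute assms(3))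
  then show ?thesis
    unfolding mobius_law_def using assms(1,2)
    by (auto simp: emeasure_density mult.assoc intro!: nn_integral_cong arg_cong2[where f="(*)"])
qed

text \<open>
  Finitely many points carry no mass, so the inclusions pin down the mass of every kind of interval
  with endpoints \<open>p\<close> and \<open>q\<close>, and only the part of \<open>A\<close> inside \<open>{0<..1}\<close> has to be controlled.
\<close>
lemma mobius_law_interval:
  assumes t: "0 \<le> t" and pq: "0 \<le> p" "p \<le> q" "q \<le> 1"
    and A: "A \<in> sets borel" "{p<..<q} \<subseteq> A" "A \<inter> {0<..1} \<subseteq> {p..q}"
  shows "emeasure (mobius_law t) A = ennreal (mobius_cdf t q - mobius_cdf t p)"
proof -
  let ?f = "\<lambda>y. (1 + t) / (1 + t * y)\<^sup>2"
  have null: "AE y in lborel. y \<notin> {p, q, 0}"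
    by (rule AE_not_in) (simp add: finite_imp_null_set_lborel)
  have "emeasure (mobius_law t) A
      = (\<integral>\<^sup>+y. ennreal (?f y) * indicator {0<..1} y * indicator A y \<partial>lborel)"
    using A(1) by (simp add: mobius_law_def emeasure_density)
  also have "\<dots> = (\<integral>\<^sup>+y. ennreal (?f y) * indicator {p..q} y \<partial>lborel)"
  proof (rule nn_integral_cong_AE, use null in eventually_elim)
    case (elim y)
    show ?case
    proof (cases "y \<in> {p<..<q}")
      case True
      then show ?thesis using A(2) pq by (auto simp: indicator_def)
    next
      case False
      then have "y \<notin> {p..q}" using elim by auto
      then show ?thesis using A(3) by (auto simp: indicator_def)
    qed
  qed
  also have "\<dots> = ennreal (mobius_cdf t q - mobius_cdf t p)"
  proof (rule nn_integral_FTC_Icc)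
    fix y assume "y \<in> {p..q}"
    then have pos: "1 + t * y > 0" using t pq(1) by (auto intro: add_pos_nonneg)
    show "(mobius_cdf t has_real_derivative ?f y) (at y)"
      unfolding mobius_cdf_def using pos
      by (auto intro!: derivative_eq_intros simp: power2_eq_square field_simps)
  qed (use t pq in auto)
  finally show ?thesis .
qed

lemma emeasure_mobius_law_UNIV:
  "0 \<le> t \<Longrightarrow> emeasure (mobius_law t) UNIV = 1"
  by (subst mobius_law_interval[of t 0 1]) (auto simp: mobius_cdf_def)

lemma mobius_law_le_1: "0 \<le> t \<Longrightarrow> emeasure (mobius_law t) A \<le> 1"
  using emeasure_space[of "mobius_law t" A] by (simp add: emeasure_mobius_law_UNIV)

text \<open>
  Large digits are visits to a short interval at \<open>0\<close>. This estimate and the next one show that its mass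
  is comparable to its length, uniformly over the laws with \<open>0 \<le> t \<le> 1\<close>.
\<close>
lemma mobius_cdf_le:
  assumes "0 \<le> t" "t \<le> 1" "0 \<le> s"
  shows "mobius_cdf t s \<le> 2 * s"
proof -
  have ts: "0 \<le> t * s" using assms by simp
  have "s * (1 + t) \<le> s * (2 + 2 * (t * s))" 
  proof (rule mult_left_mono)
    show "1 + t \<le> 2 + 2 * (t * s)" using assms ts by linarith
  qed (use assms in simp)
  then show ?thesis using ts
    by (simp add: mobius_cdf_def pos_divide_le_eq algebra_simps)
qed

lemma mobius_cdf_ge:
  assumes "0 \<le> t" "0 \<le> s" "s \<le> 1"
  shows "s \<le> mobius_cdf t s"
proof -
  have "0 < 1 + t * s" using assms by (simp add: add_pos_nonneg)
  moreover have "s * (1 + t * s) \<le> s * (1 + t)"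
    using assms by (intro mult_left_mono add_left_mono mult_left_le) auto
  ultimately show ?thesis by (simp add: mobius_cdf_def pos_le_divide_eq)
qed

text \<open>
  The inverse branch \<open>x \<mapsto> M / (a + x)\<close> is a Moebius map, so composing it with \<open>mobius_cdf t\<close> gives a
  Moebius function again. It must therefore be an affine function of \<open>mobius_cdf u\<close> for the \<open>u\<close> with the
  same pole, which is \<open>u = 1 / (a + t * M)\<close>.
\<close>
lemma mobius_cdf_branch:
  assumes t: "0 \<le> t" and M: "0 \<le> M" and a: "0 < a" and x: "0 \<le> x"
  shows "mobius_cdf t (M / (a + x)) - mobius_cdf t (M / (a + 1))
       = M * (1 + t) / ((a + t * M) * (a + 1 + t * M))
         * (mobius_cdf (1 / (a + t * M)) 1 - mobius_cdf (1 / (a + t * M)) x)"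
proof -
  define p where "p = a + t * M"
  define K where "K = M * (1 + t)"
  have p: "0 < p" using a t M by (simp add: p_def add_pos_nonneg)
  have cdf: "mobius_cdf t (M / (a + z)) = K / (p + z)" if "0 \<le> z" for z
  proof -
    have pos: "0 < a + z" using a that by simp
    then have "1 + t * (M / (a + z)) = (p + z) / (a + z)" by (simp add: p_def field_simps)
    then show ?thesis using pos by (simp add: mobius_cdf_def K_def)
  qed
  have "mobius_cdf (1 / p) z = z * (p + 1) / (p + z)" if "0 \<le> z" for z
  proof -
    have "1 + 1 / p * z = (p + z) / p" "1 + 1 / p = (p + 1) / p" using p by (simp_all add: field_simps)
    then show ?thesis using p by (simp add: mobius_cdf_def)
  qed
  moreover have "K / (p + x) - K / (p + 1) = K / (p * (p + 1)) * (1 - x * (p + 1) / (p + x))"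
  proof -
    have nz: "p \<noteq> 0" "p + 1 \<noteq> 0" "p + x \<noteq> 0" using p x by auto
    have "1 - x * (p + 1) / (p + x) = p * (1 - x) / (p + x)" using nz by (simp add: field_simps)
    moreover have "K / (p + x) - K / (p + 1) = K * (1 - x) / ((p + x) * (p + 1))"
      using nz by (simp add: diff_frac_eq algebra_simps)
    ultimately show ?thesis using nz by simp
  qed
  moreover have "a + 1 + t * M = p + 1" by (simp add: p_def)
  ultimately show ?thesis
    using x p cdf[of x] cdf[of 1] by (simp flip: p_def K_def)
qed

section \<open>The law of the image point given the first digit\<close>

lemma floor_divide_ge:
  assumes "0 < y" "y \<le> 1" "\<lfloor>real m / y\<rfloor> = int a"
  shows "m \<le> a"
proof -
  have "real m \<le> real m / y" using assms by (simp add: le_divide_eq mult_left_le)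
  then show ?thesis using assms(3) by linarith
qed

lemma mobius_law_small_digit:
  assumes "a < m" and [measurable]: "Measurable.pred borel P"
  shows "emeasure (mobius_law t) {y. \<lfloor>real m / y\<rfloor> = int a \<and> P y} = 0"
proof -
  have "emeasure (mobius_law t) {y. \<lfloor>real m / y\<rfloor> = int a \<and> P y} = emeasure (mobius_law t) {}"
    using assms(1) floor_divide_ge[of _ m a] by (intro mobius_law_cong) force+
  then show ?thesis by simp
qed

text \<open>
  A finite Borel measure on the line is determined by its values on rays, so \<open>mobius_cdf_branch\<close> identifies
  the conditional law of the image point, given that the first digit equals \<open>a\<close>, as a member of the same
  family. The parameter \<open>1 / (a + t * m)\<close> records all that the future needs to know about the past.
\<close>
lemma mobius_law_branch:
  fixes m a :: nat and t :: real
  assumes m: "1 \<le> m" and t: "0 \<le> t" and E [measurable]: "E \<in> sets borel"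
  shows "emeasure (mobius_law t) {y. \<lfloor>real m / y\<rfloor> = int a \<and> scaled_gauss_map m y \<in> E}
       = emeasure (mobius_law t) {y. \<lfloor>real m / y\<rfloor> = int a}
         * emeasure (mobius_law (1 / (real a + t * real m))) E"
proof (cases "m \<le> a")
  case False
  then show ?thesis
    using mobius_law_small_digit[of a m "\<lambda>y. scaled_gauss_map m y \<in> E" t]
      mobius_law_small_digit[of a m "\<lambda>_. True" t] by simp
next
  case True
  let ?B = "{y. \<lfloor>real m / y\<rfloor> = int a}"
  define w where "w = m * (1 + t) / ((a + t * m) * (real a + 1 + t * m))"
  define u where "u = 1 / (real a + t * real m)"
  have a: "real a \<ge> 1" "real m \<ge> 1" "real m \<le> real a" using m True by auto
  have tm: "0 \<le> t * real m" using t by simp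
  have u: "0 \<le> u" using a tm by (simp add: u_def)
  have w: "0 \<le> w" using a tm t by (simp add: w_def)
  have ray: "emeasure (mobius_law t) (?B \<inter> {y. x < scaled_gauss_map m y})
      = ennreal w * emeasure (mobius_law u) {x<..}" for x
  proof -
    \<comment> \<open>Image points lie in \<open>{0..<1}\<close>, so \<open>x\<close> may be truncated to the unit interval.\<close>
    define x' where "x' = min 1 (max 0 x)"
    have x': "0 \<le> x'" "x' \<le> 1" by (auto simp: x'_def)
    have floor_iff: "\<lfloor>real m / y\<rfloor> = int a \<longleftrightarrow> a * y \<le> m \<and> m < (real a + 1) * y" if "0 < y" for y :: real
      using that by (simp add: floor_eq_iff field_simps)
    have "emeasure (mobius_law t) (?B \<inter> {y. x < scaled_gauss_map m y})
       = ennreal (mobius_cdf t (m / (a + x')) - mobius_cdf t (m / (real a + 1)))"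
    proof (rule mobius_law_interval[OF t])
      show "?B \<inter> {y. x < scaled_gauss_map m y} \<in> sets borel" by measurable
      show "{m / (real a + 1)<..<m / (a + x')} \<subseteq> ?B \<inter> {y. x < scaled_gauss_map m y}"
      proof
        fix y assume y: "y \<in> {m / (real a + 1)<..<m / (a + x')}"
        have "0 < m / (real a + 1)" using a by simp
        moreover have y: "m / (real a + 1) < y" "y < m / (a + x')"
          using y unfolding greaterThanLessThan_iff by blast+
        ultimately have y0: "0 < y" by linarith
        have "0 < real a + 1" "0 < a + x'" using a x' by linarith+
        then have 1: "m < (real a + 1) * y" "(a + x') * y < m"
          using y by (simp_all add: pos_divide_less_eq pos_less_divide_eq mult.commute)
        have "a * y \<le> (a + x') * y" using y0 x' by simp
        then have B: "\<lfloor>real m / y\<rfloor> = int a" using 1 y0 floor_iff[OF y0] by linarith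
        have "a + x' < real m / y" using 1 y0 by (simp add: pos_less_divide_eq)
        then have "x' < real m / y - a" by simp
        moreover have "real m / y - a < 1" using B by linarith
        ultimately have "x < real m / y - a" by (auto simp: x'_def min_def max_def split: if_splits)
        then show "y \<in> ?B \<inter> {y. x < scaled_gauss_map m y}" using B by (simp add: scaled_gauss_map_def frac_def)
      qed
      show "?B \<inter> {y. x < scaled_gauss_map m y} \<inter> {0<..1} \<subseteq> {m / (real a + 1)..m / (a + x')}"
      proof clarify
        fix y assume y: "\<lfloor>real m / y\<rfloor> = int a" "x < scaled_gauss_map m y" "y \<in> {0<..1}"
        then have S: "scaled_gauss_map m y = real m / y - a" by (simp add: scaled_gauss_map_def frac_def)
        have "x' \<le> real m / y - a" "real m / y - a \<le> 1"
          using y S frac_ge_0[of "real m / y"] frac_lt_1[of "real m / y"]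
          by (auto simp: x'_def scaled_gauss_map_def)
        then have "a + x' \<le> real m / y" "real m / y \<le> real a + 1" by simp_all
        moreover have "0 < real a + 1" "0 < a + x'" using a x' by linarith+
        ultimately show "y \<in> {m / (real a + 1)..m / (a + x')}"
          using y(3) by (simp add: pos_divide_le_eq pos_le_divide_eq mult.commute)
      qed
      show "m / (real a + 1) \<le> m / (a + x')" using a x' by (intro divide_left_mono) auto
      show "m / (a + x') \<le> 1" using a x' by simp
    qed simp
    also have "mobius_cdf t (m / (a + x')) - mobius_cdf t (m / (real a + 1))
       = w * (mobius_cdf u 1 - mobius_cdf u x')"
      unfolding w_def u_def using t a x' by (intro mobius_cdf_branch) auto
    also have "ennreal \<dots> = ennreal w * ennreal (mobius_cdf u 1 - mobius_cdf u x')"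
      using w by (rule ennreal_mult')
    also have "ennreal (mobius_cdf u 1 - mobius_cdf u x') = emeasure (mobius_law u) {x<..}"
      using u x' by (intro mobius_law_interval[symmetric]) (auto simp: x'_def)
    finally show ?thesis .
  qed
  \<comment> \<open>The ray from \<open>-1\<close> contains all image points, so the case \<open>x = -1\<close> gives the normalising factor.\<close>
  have wB: "emeasure (mobius_law t) ?B = ennreal w"
  proof -
    have "?B \<inter> {y. -1 < scaled_gauss_map m y} = ?B"
      by (auto simp: scaled_gauss_map_def intro: less_le_trans[OF _ frac_ge_0])
    moreover have "emeasure (mobius_law u) {-1<..} = 1"
      by (subst mobius_law_cong[of _ UNIV]) (auto simp: emeasure_mobius_law_UNIV[OF u])
    ultimately show ?thesis using ray[of "-1"] by simp
  qed
  have restr: "emeasure (distr (density (mobius_law t) (indicator ?B)) borel (scaled_gauss_map m)) X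
      = emeasure (mobius_law t) (?B \<inter> scaled_gauss_map m -` X)" if X [measurable]: "X \<in> sets borel" for X
  proof -
    have "?B \<in> sets (mobius_law t)" "scaled_gauss_map m -` X \<in> sets (mobius_law t)"
      using measurable_sets_borel[OF measurable_scaled_gauss_map that] by measurable
    then show ?thesis by (simp add: emeasure_distr emeasure_restricted)
  qed
  have "distr (density (mobius_law t) (indicator ?B)) borel (scaled_gauss_map m)
      = scale_measure (ennreal w) (mobius_law u)"
  proof (rule measure_eqI_lessThan)
    fix x :: real
    show eq: "emeasure (distr (density (mobius_law t) (indicator ?B)) borel (scaled_gauss_map m)) {x<..}
      = emeasure (scale_measure (ennreal w) (mobius_law u)) {x<..}"
      using ray[of x] by (simp add: restr vimage_def)
    show "emeasure (distr (density (mobius_law t) (indicator ?B)) borel (scaled_gauss_map m)) {x<..} < \<infinity>"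
      using le_less_trans[OF mobius_law_le_1[OF t]] by (simp add: restr)
  qed auto
  then have "emeasure (mobius_law t) (?B \<inter> scaled_gauss_map m -` E) = ennreal w * emeasure (mobius_law u) E"
    using restr[OF E] by simp
  then show ?thesis by (simp add: wB u_def Int_def vimage_def)
qed

section \<open>Uniform bounds along the orbit\<close>

text \<open>
  Summing over natural digits suffices, because the law lives on positive points.
\<close>
lemma mobius_law_split_digit:
  assumes [measurable]: "Measurable.pred borel Q"
  shows "emeasure (mobius_law t) {y. P \<lfloor>real m / y\<rfloor> \<and> Q y}
     = (\<Sum>a. if P (int a) then emeasure (mobius_law t) {y. \<lfloor>real m / y\<rfloor> = int a \<and> Q y} else 0)"
proof -
  let ?B = "\<lambda>a. {y. P (int a) \<and> \<lfloor>real m / y\<rfloor> = int a \<and> Q y}"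
  have meas: "?B a \<in> sets borel" for a
    by measurable
  have "emeasure (mobius_law t) {y. P \<lfloor>real m / y\<rfloor> \<and> Q y} = emeasure (mobius_law t) (\<Union>a. ?B a)"
  proof (rule mobius_law_cong)
    show "{y. P \<lfloor>real m / y\<rfloor> \<and> Q y} \<inter> {0<..1} = (\<Union>a. ?B a) \<inter> {0<..1}"
    proof (intro set_eqI iffI)
      fix y assume y: "y \<in> {y. P \<lfloor>real m / y\<rfloor> \<and> Q y} \<inter> {0<..1}"
      then have "\<lfloor>real m / y\<rfloor> = int (nat \<lfloor>real m / y\<rfloor>)" by simp
      then show "y \<in> (\<Union>a. ?B a) \<inter> {0<..1}" using y by (auto intro!: exI[of _ "nat \<lfloor>real m / y\<rfloor>"])
    qed auto
  qed (use meas in measurable)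
  also have "\<dots> = (\<Sum>a. emeasure (mobius_law t) (?B a))"
    using meas by (intro suminf_emeasure[symmetric]) (auto simp: disjoint_family_on_def)
  also have "\<dots> = (\<Sum>a. if P (int a) then emeasure (mobius_law t) {y. \<lfloor>real m / y\<rfloor> = int a \<and> Q y} else 0)"
    by (intro suminf_cong) auto
  finally show ?thesis .
qed

text \<open>
  A bound that is uniform over the family \<open>t \<in> {0..1}\<close> survives conditioning on the first digit, because
  each conditional law belongs to the family: \<open>a + t * m \<ge> 1\<close> for all digits \<open>a \<ge> m\<close> that occur. Summing
  over the digits allowed by \<open>P\<close> shows that the event \<open>E\<close>, one step later, behaves as if it were
  independent of the first digit, up to an inequality. This replaces the mixing properties of the map.
\<close>
lemma mobius_law_transfer:
  assumes m: "1 \<le> m" and t: "0 \<le> t" and E [measurable]: "E \<in> sets borel"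
    and bound: "\<And>u. 0 \<le> u \<Longrightarrow> u \<le> 1 \<Longrightarrow> emeasure (mobius_law u) E \<le> r"
  shows "emeasure (mobius_law t) {y. P \<lfloor>real m / y\<rfloor> \<and> scaled_gauss_map m y \<in> E}
       \<le> emeasure (mobius_law t) {y. P \<lfloor>real m / y\<rfloor>} * r"
proof -
  let ?p = "\<lambda>a. emeasure (mobius_law t) {y. \<lfloor>real m / y\<rfloor> = int a}"
  have branch: "emeasure (mobius_law t) {y. \<lfloor>real m / y\<rfloor> = int a \<and> scaled_gauss_map m y \<in> E} \<le> ?p a * r" for a
  proof (cases "m \<le> a")
    case True
    have "1 \<le> real a + t * real m" using m True t by (intro order_trans[OF _ add_increasing2]) auto
    then show ?thesis
      unfolding mobius_law_branch[OF m t E] by (intro mult_left_mono bound) auto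
  next
    case False
    then show ?thesis using mobius_law_small_digit[of a m "\<lambda>y. scaled_gauss_map m y \<in> E" t] by simp
  qed
  have "emeasure (mobius_law t) {y. P \<lfloor>real m / y\<rfloor> \<and> scaled_gauss_map m y \<in> E}
     = (\<Sum>a. if P (int a) then emeasure (mobius_law t) {y. \<lfloor>real m / y\<rfloor> = int a \<and> scaled_gauss_map m y \<in> E} else 0)"
    by (rule mobius_law_split_digit) measurable
  also have "\<dots> \<le> (\<Sum>a. (if P (int a) then ?p a else 0) * r)"
    using branch by (intro suminf_le) auto
  also have "\<dots> = emeasure (mobius_law t) {y. P \<lfloor>real m / y\<rfloor>} * r"
    using mobius_law_split_digit[of "\<lambda>_. True" t P m] by (simp cong: if_cong)
  finally show ?thesis .
qed

lemma measurable_scaled_gauss_map_funpow [measurable]: "scaled_gauss_map m ^^ n \<in> borel_measurable borel"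
  by (rule measurable_compose_n) simp

lemma mobius_law_iterate:
  assumes m: "1 \<le> m" and E [measurable]: "E \<in> sets borel"
    and bound: "\<And>u. 0 \<le> u \<Longrightarrow> u \<le> 1 \<Longrightarrow> emeasure (mobius_law u) E \<le> r"
    and t: "0 \<le> t" "t \<le> 1"
  shows "emeasure (mobius_law t) {y. (scaled_gauss_map m ^^ n) y \<in> E} \<le> r"
  using t
proof (induction n arbitrary: t)
  case 0
  then show ?case using bound by simp
next
  case (Suc n)
  have "{y. (scaled_gauss_map m ^^ n) y \<in> E} \<in> sets borel" by measurable
  from mobius_law_transfer[OF m Suc.prems(1) this Suc.IH, of "\<lambda>_. True"] Suc.prems
  show ?case by (simp add: funpow_Suc_right emeasure_mobius_law_UNIV del: funpow.simps)
qed

section \<open>Probabilities of large digits\<close>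

text \<open>
  At \<open>z = 0\<close> the digit is infinite, but the default value \<open>m / 0 = 0\<close> would make it \<open>0\<close>; hence the
  separate disjunct.
\<close>
definition large_digit_set :: "nat \<Rightarrow> real \<Rightarrow> real set" where
  "large_digit_set m c = {z. z = 0 \<or> c < real_of_int \<lfloor>real m / z\<rfloor>}"

lemma measurable_large_digit_set [measurable]: "large_digit_set m c \<in> sets borel"
  unfolding large_digit_set_def by measurable

lemma mobius_law_large_digit_le:
  assumes c: "0 < c" and t: "0 \<le> t" "t \<le> 1"
  shows "emeasure (mobius_law t) (large_digit_set m c) \<le> ennreal (2 * real m / c)"
proof (cases "m / c \<le> 1")
  case True
  have "emeasure (mobius_law t) (large_digit_set m c) = emeasure (mobius_law t) (large_digit_set m c \<inter> {0<..1})"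
    by (rule mobius_law_cong) auto
  also have "\<dots> \<le> emeasure (mobius_law t) {0..m / c}"
  proof (rule emeasure_mono)
    show "large_digit_set m c \<inter> {0<..1} \<subseteq> {0..m / c}"
    proof
      fix z assume z: "z \<in> large_digit_set m c \<inter> {0<..1}"
      then have "c < real m / z" by (auto simp: large_digit_set_def intro: less_le_trans)
      then show "z \<in> {0..m / c}" using z c by (simp add: field_simps)
    qed
  qed simp
  also have "\<dots> = ennreal (mobius_cdf t (m / c) - mobius_cdf t 0)"
    using True c t by (intro mobius_law_interval) auto
  also have "\<dots> \<le> ennreal (2 * (m / c))"
    using mobius_cdf_le[of t "m / c"] c t by (intro ennreal_leI) (simp add: mobius_cdf_def)
  finally show ?thesis by simp
next
  case False
  then have "1 \<le> 2 * real m / c" by simp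
  then have "1 \<le> ennreal (2 * real m / c)" by (metis ennreal_1 ennreal_leI)
  then show ?thesis by (rule order_trans[OF mobius_law_le_1[OF t(1)]])
qed

lemma mobius_law_digit_le:
  assumes m: "1 \<le> m" and c: "0 < c" and t: "0 \<le> t"
  shows "emeasure (mobius_law t) {y. real_of_int \<lfloor>real m / y\<rfloor> \<le> c} \<le> ennreal (1 - 1 / (c + 1))"
proof -
  let ?A = "{y. real_of_int \<lfloor>real m / y\<rfloor> \<le> c}"
  have "emeasure (mobius_law t) ?A = emeasure (mobius_law t) (?A \<inter> {0<..1})"
    by (rule mobius_law_cong) auto
  also have "\<dots> \<le> emeasure (mobius_law t) {1 / (c + 1)..1}"
  proof (rule emeasure_mono)
    show "?A \<inter> {0<..1} \<subseteq> {1 / (c + 1)..1}"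
    proof
      fix y assume y: "y \<in> ?A \<inter> {0<..1}"
      then have "real m / y < c + 1" "0 < y" by (auto, linarith)
      then have "real m < (c + 1) * y" by (simp add: pos_divide_less_eq)
      then have "1 \<le> (c + 1) * y" using m by linarith
      then show "y \<in> {1 / (c + 1)..1}" using y c by (simp add: pos_divide_le_eq mult.commute)
    qed
  qed simp
  also have "\<dots> = ennreal (mobius_cdf t 1 - mobius_cdf t (1 / (c + 1)))"
    using c t by (intro mobius_law_interval) auto
  also have "\<dots> \<le> ennreal (1 - 1 / (c + 1))"
    using mobius_cdf_ge[of t "1 / (c + 1)"] c t by (intro ennreal_leI) (simp add: mobius_cdf_def)
  finally show ?thesis .
qed

text \<open>
  Splitting off the first digit, \<open>mobius_law_transfer\<close> contributes one factor per step, which is the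
  estimate one would have for independent digits. The induction has to run over all \<open>t\<close> at once, since
  the law changes from step to step.
\<close>
lemma mobius_law_no_large_digit:
  fixes \<psi> :: "nat \<Rightarrow> real"
  assumes m: "1 \<le> m" and \<psi>: "\<And>j. 0 < \<psi> j" and t: "0 \<le> t" "t \<le> 1"
  shows "emeasure (mobius_law t) {y. \<forall>j<k. (scaled_gauss_map m ^^ j) y \<notin> large_digit_set m (\<psi> j)}
       \<le> ennreal (\<Prod>j<k. 1 - 1 / (\<psi> j + 1))"
  using \<psi> t
proof (induction k arbitrary: \<psi> t)
  case 0
  then show ?case by (simp add: emeasure_mobius_law_UNIV)
next
  case (Suc k)
  let ?E = "{y. \<forall>j<k. (scaled_gauss_map m ^^ j) y \<notin> large_digit_set m (\<psi> (Suc j))}"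
  let ?\<rho> = "\<Prod>j<k. 1 - 1 / (\<psi> (Suc j) + 1)"
  have pos: "0 \<le> 1 - 1 / (\<psi> j + 1)" for j
    using Suc.prems(1)[of j] by simp
  have E [measurable]: "?E \<in> sets borel" by measurable
  have "emeasure (mobius_law t) {y. \<forall>j<Suc k. (scaled_gauss_map m ^^ j) y \<notin> large_digit_set m (\<psi> j)}
     \<le> emeasure (mobius_law t) {y. real_of_int \<lfloor>real m / y\<rfloor> \<le> \<psi> 0 \<and> scaled_gauss_map m y \<in> ?E}"
  proof (rule emeasure_mono)
    show "{y. \<forall>j<Suc k. (scaled_gauss_map m ^^ j) y \<notin> large_digit_set m (\<psi> j)}
      \<subseteq> {y. real_of_int \<lfloor>real m / y\<rfloor> \<le> \<psi> 0 \<and> scaled_gauss_map m y \<in> ?E}"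
      unfolding All_less_Suc2
      by (auto simp: large_digit_set_def funpow_Suc_right simp del: funpow.simps(2))
    have "{y. real_of_int \<lfloor>real m / y\<rfloor> \<le> \<psi> 0 \<and> scaled_gauss_map m y \<in> ?E} \<in> sets borel"
      by measurable
    then show "{y. real_of_int \<lfloor>real m / y\<rfloor> \<le> \<psi> 0 \<and> scaled_gauss_map m y \<in> ?E} \<in> sets (mobius_law t)" by simp
  qed
  also have "\<dots> \<le> emeasure (mobius_law t) {y. real_of_int \<lfloor>real m / y\<rfloor> \<le> \<psi> 0} * ennreal ?\<rho>"
    using Suc.prems by (intro mobius_law_transfer[OF m _ E] Suc.IH) auto
  also have "\<dots> \<le> ennreal (1 - 1 / (\<psi> 0 + 1)) * ennreal ?\<rho>"
    using Suc.prems by (intro mult_right_mono mobius_law_digit_le[OF m]) auto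
  also have "\<dots> = ennreal (\<Prod>j<Suc k. 1 - 1 / (\<psi> j + 1))"
    using pos by (simp add: prod.lessThan_Suc_shift ennreal_mult prod_nonneg del: prod.lessThan_Suc)
  finally show ?case .
qed

lemma prod_one_minus_le_exp:
  fixes c :: "nat \<Rightarrow> real"
  assumes "\<And>j. c j \<le> 1"
  shows "(\<Prod>j<k. 1 - c j) \<le> exp (- (\<Sum>j<k. c j))"
proof -
  have "1 - x \<le> exp (- x)" for x :: real
    using exp_ge_add_one_self[of "- x"] by simp
  then have "(\<Prod>j<k. 1 - c j) \<le> (\<Prod>j<k. exp (- c j))"
    using assms by (intro prod_mono) simp
  then show ?thesis by (simp add: exp_sum flip: sum_negf)
qed

text \<open>
  The summand \<open>1\<close> comes from taking integer parts. It does not affect summability, since \<open>\<psi>\<close> tends to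
  infinity whenever the shifted series converges.
\<close>
lemma summable_inverse_if_summable_inverse_plus_one:
  fixes \<psi> :: "nat \<Rightarrow> real"
  assumes \<psi>: "\<And>j. 0 < \<psi> j" and sum: "summable (\<lambda>j. 1 / (\<psi> j + 1))"
  shows "summable (\<lambda>j. 1 / \<psi> j)"
proof (rule summable_comparison_test_ev)
  show "summable (\<lambda>j. 2 * (1 / (\<psi> j + 1)))" using sum by (rule summable_mult)
  have "(\<lambda>j. 1 / (\<psi> j + 1)) \<longlonglongrightarrow> 0" using sum by (rule summable_LIMSEQ_zero)
  then have "\<forall>\<^sub>F j in sequentially. 1 / (\<psi> j + 1) < 1 / 2"
    by (rule order_tendstoD) simp
  then show "\<forall>\<^sub>F j in sequentially. norm (1 / \<psi> j) \<le> 2 * (1 / (\<psi> j + 1))"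
  proof eventually_elim
    case (elim j)
    then show ?case using \<psi>[of j] by (simp add: field_simps)
  qed
qed

text \<open>
  If the series diverges then, for every \<open>N\<close>, seeing no large digit from time \<open>N\<close> on has probability
  at most \<open>\<Prod>j. 1 - 1 / (\<psi> (N + j) + 1) = 0\<close>.
\<close>
lemma mobius_law_infinitely_many_large_digits:
  fixes \<psi> :: "nat \<Rightarrow> real"
  assumes m: "1 \<le> m" and \<psi>: "\<And>j. 0 < \<psi> j" and div: "\<not> summable (\<lambda>j. 1 / \<psi> j)"
    and t: "0 \<le> t" "t \<le> 1"
  shows "AE y in mobius_law t. \<exists>\<^sub>F n in sequentially. (scaled_gauss_map m ^^ n) y \<in> large_digit_set m (\<psi> n)"
proof -
  let ?X = "\<lambda>N. {y. \<forall>j. (scaled_gauss_map m ^^ j) y \<notin> large_digit_set m (\<psi> (N + j))}"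
  have X [measurable]: "?X N \<in> sets borel" for N by measurable
  have X0: "emeasure (mobius_law u) (?X N) \<le> 0" if u: "0 \<le> u" "u \<le> 1" for N u
  proof (rule LIMSEQ_le_const)
    have "(\<lambda>K. exp (- real K)) \<longlonglongrightarrow> 0"
      by real_asymp
    then show "(\<lambda>K. ennreal (exp (- real K))) \<longlonglongrightarrow> 0"
      using tendsto_ennrealI by fastforce
    have "emeasure (mobius_law u) (?X N) \<le> ennreal (exp (- real K))" for K
    proof -
      let ?c = "\<lambda>j. 1 / (\<psi> (N + j) + 1)"
      have c: "0 \<le> ?c j" "?c j \<le> 1" for j
        using \<psi>[of "N + j"] by auto
      have "\<not> summable (\<lambda>j. 1 / \<psi> (N + j))"
        using div summable_iff_shift[of "\<lambda>j. 1 / \<psi> j" N] by (simp add: add.commute)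
      then have "\<not> summable ?c"
        using summable_inverse_if_summable_inverse_plus_one[of "\<lambda>j. \<psi> (N + j)"] \<psi> by blast
      then obtain k where "real K < (\<Sum>j<k. ?c j)"
        using c(1) summableI_nonneg_bounded[of ?c "real K"] by (meson not_le)
      then have "(\<Prod>j<k. 1 - ?c j) \<le> exp (- real K)"
        using prod_one_minus_le_exp[of ?c k, OF c(2)] by (smt (verit) exp_le_cancel_iff)
      moreover have "emeasure (mobius_law u) (?X N)
          \<le> emeasure (mobius_law u) {y. \<forall>j<k. (scaled_gauss_map m ^^ j) y \<notin> large_digit_set m (\<psi> (N + j))}"
      proof (rule emeasure_mono)
        have "{y. \<forall>j<k. (scaled_gauss_map m ^^ j) y \<notin> large_digit_set m (\<psi> (N + j))} \<in> sets borel" by measurable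
        then show "{y. \<forall>j<k. (scaled_gauss_map m ^^ j) y \<notin> large_digit_set m (\<psi> (N + j))} \<in> sets (mobius_law u)" by simp
      qed auto
      ultimately show ?thesis
        using mobius_law_no_large_digit[of m "\<lambda>j. \<psi> (N + j)" u k, OF m \<psi> u]
        by (meson ennreal_leI order_trans)
    qed
    then show "\<exists>N0. \<forall>K\<ge>N0. emeasure (mobius_law u) (?X N) \<le> ennreal (exp (- real K))" by blast
  qed
  have null: "emeasure (mobius_law t) {y. (scaled_gauss_map m ^^ N) y \<in> ?X N} = 0" for N
    using mobius_law_iterate[OF m X X0 t, of N N] by simp
  have "AE y in mobius_law t. (scaled_gauss_map m ^^ N) y \<notin> ?X N" for N
  proof -
    have "{y. (scaled_gauss_map m ^^ N) y \<in> ?X N} \<in> sets borel" by measurable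
    then show ?thesis
      using null[of N] by (intro AE_I[of _ _ "{y. (scaled_gauss_map m ^^ N) y \<in> ?X N}"]) auto
  qed
  then have "AE y in mobius_law t. \<forall>N. (scaled_gauss_map m ^^ N) y \<notin> ?X N"
    by (simp add: AE_all_countable)
  then show ?thesis
  proof eventually_elim
    case (elim y)
    show ?case
      unfolding frequently_sequentially
    proof
      fix N
      from elim obtain j where "(scaled_gauss_map m ^^ j) ((scaled_gauss_map m ^^ N) y) \<in> large_digit_set m (\<psi> (N + j))" by auto
      then have "(scaled_gauss_map m ^^ (N + j)) y \<in> large_digit_set m (\<psi> (N + j))"
        by (simp add: funpow_add add.commute[of N j])
      then show "\<exists>n\<ge>N. (scaled_gauss_map m ^^ n) y \<in> large_digit_set m (\<psi> n)" by (intro exI[of _ "N + j"]) simp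
    qed
  qed
qed

text \<open>
  The first Borel-Cantelli lemma applies, because \<open>mobius_law_iterate\<close> bounds the probability of a large
  digit at time \<open>n\<close> by a multiple of \<open>1 / \<psi> n\<close>.
\<close>
lemma mobius_law_finitely_many_large_digits:
  fixes \<psi> :: "nat \<Rightarrow> real"
  assumes m: "1 \<le> m" and \<psi>: "\<And>j. 0 < \<psi> j" and sum: "summable (\<lambda>j. 1 / \<psi> j)"
    and t: "0 \<le> t" "t \<le> 1"
  shows "AE y in mobius_law t. \<forall>\<^sub>F n in sequentially. (scaled_gauss_map m ^^ n) y \<notin> large_digit_set m (\<psi> n)"
proof -
  let ?A = "\<lambda>n. {y. (scaled_gauss_map m ^^ n) y \<in> large_digit_set m (\<psi> n)}"
  have A: "?A n \<in> sets (mobius_law t)" for n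
  proof -
    have "?A n \<in> sets borel" by measurable
    then show ?thesis by simp
  qed
  have le: "emeasure (mobius_law t) (?A n) \<le> ennreal (2 * real m / \<psi> n)" for n
    using \<psi> t by (intro mobius_law_iterate[OF m] mobius_law_large_digit_le) auto
  have "summable (\<lambda>n. measure (mobius_law t) (?A n))"
  proof (rule summable_comparison_test)
    have "measure (mobius_law t) (?A n) \<le> 2 * real m * (1 / \<psi> n)" for n
      using enn2real_mono[OF le[of n]] \<psi>[of n] by (simp add: measure_def less_imp_le)
    then show "\<exists>N. \<forall>n\<ge>N. norm (measure (mobius_law t) (?A n)) \<le> 2 * real m * (1 / \<psi> n)" by simp
    show "summable (\<lambda>n. 2 * real m * (1 / \<psi> n))" using sum by (rule summable_mult)
  qed
  moreover have "emeasure (mobius_law t) (?A n) < \<infinity>" for n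
    using le_less_trans[OF mobius_law_le_1[OF t(1)]] by simp
  ultimately have "AE y in mobius_law t. \<forall>\<^sub>F n in sequentially. y \<in> space (mobius_law t) - ?A n"
    using A by (intro borel_cantelli_AE1)
  then show ?thesis by eventually_elim (simp add: eventually_mono)
qed

section \<open>Transfer to the original expansion\<close>

lemma T_map_conjugate:
  assumes "0 < \<theta>" "\<theta> * \<theta> * real m = 1"
  shows "T_map \<theta> (\<theta> * y) = \<theta> * scaled_gauss_map m y"
proof (cases "y = 0")
  case False
  have "1 / (\<theta> * y) = \<theta> * (real m / y)" "1 / (\<theta> * y * \<theta>) = real m / y"
    using assms False by (simp_all add: field_simps)
  then show ?thesis using assms False by (simp add: T_map_def scaled_gauss_map_def frac_def right_diff_distrib)
qed (simp add: T_map_def scaled_gauss_map_def)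

lemma T_map_funpow_conjugate:
  assumes "0 < \<theta>" "\<theta> * \<theta> * real m = 1"
  shows "(T_map \<theta> ^^ n) (\<theta> * y) = \<theta> * (scaled_gauss_map m ^^ n) y"
  by (induction n) (simp_all add: T_map_conjugate[OF assms])

lemma scaled_gauss_map_funpow_nonneg: "0 \<le> y \<Longrightarrow> 0 \<le> (scaled_gauss_map m ^^ n) y"
  by (cases n) (simp_all add: scaled_gauss_map_def)

lemma first_digit_gt_iff:
  assumes \<theta>: "0 < \<theta>" "\<theta> * \<theta> * real m = 1" and z: "0 \<le> z" and c: "0 < c"
  shows "ereal c < ereal_of_enat (first_digit \<theta> (\<theta> * z)) \<longleftrightarrow> z \<in> large_digit_set m c"
proof (cases "z = 0")
  case False
  have "1 / (\<theta> * z * \<theta>) = real m / z" using \<theta> False by (simp add: field_simps)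
  then show ?thesis
    using \<theta>(1) z False by (simp add: first_digit_def large_digit_set_def)
qed (simp add: first_digit_def large_digit_set_def)

text \<open>
  Digits are counted from \<open>1\<close> while iterates are counted from \<open>0\<close>, hence the shift to \<open>\<phi> (Suc n)\<close>.
\<close>
lemma A_set_conjugate:
  assumes \<theta>: "0 < \<theta>" "\<theta> * \<theta> * real m = 1" and \<phi>: "\<And>n. n \<ge> 1 \<Longrightarrow> \<phi> n > 0"
    and y: "0 < y" "y < 1"
  shows "\<theta> * y \<in> A_set \<theta> \<phi> \<longleftrightarrow>
    \<theta> * y \<notin> \<rat> \<and> (\<exists>\<^sub>F n in sequentially. (scaled_gauss_map m ^^ n) y \<in> large_digit_set m (\<phi> (Suc n)))"
proof -
  let ?D = "{n. 1 \<le> n \<and> ereal_of_enat (digit \<theta> n (\<theta> * y)) > ereal (\<phi> n)}"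
  have "?D = Suc ` {n. (scaled_gauss_map m ^^ n) y \<in> large_digit_set m (\<phi> (Suc n))}" (is "_ = Suc ` ?L")
  proof (intro set_eqI iffI)
    fix k assume "k \<in> ?D"
    then show "k \<in> Suc ` ?L"
      using y \<theta> \<phi> by (cases k) (auto simp: digit_def T_map_funpow_conjugate[OF \<theta>] first_digit_gt_iff scaled_gauss_map_funpow_nonneg)
  next
    fix k assume "k \<in> Suc ` ?L"
    then show "k \<in> ?D"
      using y \<theta> \<phi> by (auto simp: digit_def T_map_funpow_conjugate[OF \<theta>] first_digit_gt_iff scaled_gauss_map_funpow_nonneg)
  qed
  then have "infinite ?D \<longleftrightarrow> (\<exists>\<^sub>F n in sequentially. (scaled_gauss_map m ^^ n) y \<in> large_digit_set m (\<phi> (Suc n)))"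
    by (simp add: finite_image_iff frequently_cofinite flip: cofinite_eq_sequentially)
  then show ?thesis using y \<theta> by (simp add: A_set_def Omega_def)
qed

text \<open>
  For \<open>t = 0\<close> the density is constant, so \<open>mobius_law 0\<close> is Lebesgue measure on the unit interval.
\<close>
lemma emeasure_lambda_measure:
  assumes \<theta>: "0 < \<theta>" and X: "X \<in> sets borel" "X \<subseteq> {0<..<\<theta>}"
  shows "emeasure (lambda_measure \<theta>) X = emeasure (mobius_law 0) {y. \<theta> * y \<in> X}"
proof -
  have meas: "{y. \<theta> * y \<in> X} \<in> sets borel"
    using measurable_sets_borel[of "(*) \<theta>" borel X] X(1) by (simp add: vimage_def)
  have "emeasure (lambda_measure \<theta>) X = ennreal (1 / \<theta>) * emeasure lborel X"
  proof -
    have "X \<subseteq> {0..\<theta>}" using X(2) by auto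
    then show ?thesis by (simp add: lambda_measure_def emeasure_restrict_space)
  qed
  also have "\<dots> = emeasure (density lborel (\<lambda>_. ennreal (inverse \<bar>\<theta>\<bar>))) X"
    using \<theta> X by (simp add: emeasure_density_const inverse_eq_divide)
  also have "\<dots> = emeasure (distr lborel borel ((*) \<theta>)) X"
    using \<theta> by (simp add: lborel_distr_mult)
  also have "\<dots> = emeasure lborel {y. \<theta> * y \<in> X}"
    using X by (simp add: emeasure_distr vimage_def)
  also have "\<dots> = emeasure (mobius_law 0) {y. \<theta> * y \<in> X}"
  proof -
    have "y \<in> {0<..1}" if "\<theta> * y \<in> X" for y
      using X(2) that \<theta> by (auto simp: zero_less_mult_iff)
    then have "indicator {0<..1} y * indicator {y. \<theta> * y \<in> X} y = (indicator {y. \<theta> * y \<in> X} y :: ennreal)" for y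
      by (auto simp: indicator_def)
    then show ?thesis using meas by (simp add: mobius_law_def emeasure_density)
  qed
  finally show ?thesis .
qed

lemma AE_mobius_law_0:
  assumes "AE y in lborel. 0 < y \<longrightarrow> y \<le> 1 \<longrightarrow> P y"
  shows "AE y in mobius_law 0. P y"
  unfolding mobius_law_def using assms
  by (subst AE_density) (auto simp: indicator_def elim!: eventually_mono)

theorem theorem3p1:
  fixes m :: nat and \<theta> :: real and \<phi> :: "nat \<Rightarrow> real"
  assumes "m \<ge> 1"
    and "\<theta> = 1 / sqrt (real m)"
    and "\<And>n. n \<ge> 1 \<Longrightarrow> \<phi> n > 0"
  shows "A_set \<theta> \<phi> \<in> sets (lambda_measure \<theta>) \<and>
    emeasure (lambda_measure \<theta>) (A_set \<theta> \<phi>) =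
      (if summable (\<lambda>n. 1 / \<phi> (Suc n)) then 0 else 1)"
proof
  have \<theta>: "0 < \<theta>" "\<theta> * \<theta> * real m = 1"
    using assms(1,2) by auto
  define L where
    "L = {y. \<exists>\<^sub>F n in sequentially. (scaled_gauss_map m ^^ n) y \<in> large_digit_set m (\<phi> (Suc n))}"
  have L [measurable]: "L \<in> sets borel"
    unfolding L_def frequently_sequentially by measurable
  have rat [measurable]: "(\<rat> :: real set) \<in> sets borel"
    using null_setsD2[OF countable_imp_null_set_lborel[OF countable_rat]] by simp
  have sub: "A_set \<theta> \<phi> \<subseteq> {0<..<\<theta>}"
    by (auto simp: A_set_def Omega_def)
  have mem: "x \<in> A_set \<theta> \<phi> \<longleftrightarrow> x \<notin> \<rat> \<and> x / \<theta> \<in> L" if "x \<in> {0<..<\<theta>}" for x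
    using A_set_conjugate[where y = "x / \<theta>", OF \<theta> assms(3)] that \<theta>(1) by (simp add: L_def)
  have "A_set \<theta> \<phi> = {x \<in> {0<..<\<theta>}. x \<notin> \<rat> \<and> x / \<theta> \<in> L}"
    using sub mem by blast
  also have "\<dots> \<in> sets borel" by measurable
  finally have meas: "A_set \<theta> \<phi> \<in> sets borel" .
  then show "A_set \<theta> \<phi> \<in> sets (lambda_measure \<theta>)"
    using sub by (auto simp: lambda_measure_def sets_restrict_space_iff)
  \<comment> \<open>Membership in \<open>A_set\<close> and in \<open>L\<close> can differ only where \<open>\<theta> * y\<close> is rational or \<open>y = 1\<close>.\<close>
  have "countable ((\<lambda>q. q / \<theta>) ` \<rat> \<union> {1})"
    by (simp add: countable_rat)
  then have "AE y in lborel. y \<notin> (\<lambda>q. q / \<theta>) ` \<rat> \<union> {1}"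
    by (intro AE_not_in countable_imp_null_set_lborel)
  then have generic: "AE y in mobius_law 0. \<theta> * y \<in> {0<..<\<theta>} \<and> \<theta> * y \<notin> \<rat>"
  proof (intro AE_mobius_law_0, eventually_elim)
    case (elim y)
    then show ?case using \<theta>(1) by (force simp: image_iff)
  qed
  then have AE_iff: "AE y in mobius_law 0. \<theta> * y \<in> A_set \<theta> \<phi> \<longleftrightarrow> y \<in> L"
  proof (rule eventually_mono)
    fix y assume "\<theta> * y \<in> {0<..<\<theta>} \<and> \<theta> * y \<notin> \<rat>"
    then show "\<theta> * y \<in> A_set \<theta> \<phi> \<longleftrightarrow> y \<in> L" using mem[of "\<theta> * y"] \<theta>(1) by simp
  qed
  have "emeasure (lambda_measure \<theta>) (A_set \<theta> \<phi>) = emeasure (mobius_law 0) {y. \<theta> * y \<in> A_set \<theta> \<phi>}"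
    by (rule emeasure_lambda_measure[OF \<theta>(1) meas sub])
  also have "\<dots> = emeasure (mobius_law 0) L"
  proof (rule emeasure_eq_AE)
    show "{y. \<theta> * y \<in> A_set \<theta> \<phi>} \<in> sets (mobius_law 0)"
      using measurable_sets_borel[of "(*) \<theta>" borel, OF _ meas] by (simp add: vimage_def)
  qed (use AE_iff L in simp_all)
  also have "\<dots> = (if summable (\<lambda>n. 1 / \<phi> (Suc n)) then 0 else 1)"
  proof (cases "summable (\<lambda>n. 1 / \<phi> (Suc n))")
    case True
    have "AE y in mobius_law 0. y \<notin> L"
      using mobius_law_finitely_many_large_digits[OF assms(1) _ True, of 0] assms(3)
      by (simp add: L_def not_frequently)
    then have "emeasure (mobius_law 0) L = emeasure (mobius_law 0) {}"
      by (intro emeasure_eq_AE) auto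
    then show ?thesis using True by simp
  next
    case False
    have "AE y in mobius_law 0. y \<in> L"
      using mobius_law_infinitely_many_large_digits[OF assms(1) _ False, of 0] assms(3)
      by (simp add: L_def)
    then have "emeasure (mobius_law 0) L = emeasure (mobius_law 0) UNIV"
      by (intro emeasure_eq_AE) auto
    then show ?thesis using False by (simp add: emeasure_mobius_law_UNIV)
  qed
  finally show "emeasure (lambda_measure \<theta>) (A_set \<theta> \<phi>) =
      (if summable (\<lambda>n. 1 / \<phi> (Suc n)) then 0 else 1)" .
qed

end
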